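(* There is a linearly repetitive Delone set $X$ in $\mathbb{R}^n$ (with $\mathbf{0}\in X$, an address map $\phi:[X]\to\mathbb{Z}^s$, and associated linear map $L:\mathbb{R}^n\to\mathbb{R}^s$) which has the property that there is a constant $\delta=\delta(X)<1$ and a sequence $\{\mathbf{x}_i\}\subseteq X$ with $\|\mathbf{x}_i\|\to\infty$ such that $$\|\phi(\mathbf{x}_i)-L(\mathbf{x}_i)\|>\|\mathbf{x}_i\|^{1-\delta}\quad\text{for all }i.$$
   Context: A Delone set in $\mathbb{R}^n$ is a set $X\subset\mathbb{R}^n$ for which there are $r,R>0$ such that each open ball of radius $r$ contains at most one point of $X$ and each closed ball of radius $R$ contains at least one point of $X$. $B(\mathbf{x};T)$ is the closed ball of radius $T$ centered at $\mathbf{x}$. $X$ is repetitive if for each $T>0$ there is a finite $M>0$ such that every closed ball of radius $M$ in $\mathbb{R}^n$ contains, for every $\mathbf{y}\in X$, some $\mathbf{x}\in X$ with $(X\cap B(\mathbf{x};T))-\mathbf{x}=(X\cap B(\mathbf{y};T))-\mathbf{y}$; $M_X(T)$ denotes the least such $M$. A repetitive $X$ is linearly repetitive if $M_X(T)=O(T)$ as $T\to\infty$. For such $X$ the additive subgroup $[X]$ of $\mathbb{R}^n$ generated by $X$ is a finitely generated free abelian group; if its rank is $s$, an address map $\phi:[X]\to\mathbb{Z}^s$ is the isomorphism determined by a chosen $\mathbb{Z}$-basis $\{\mathbf{y}_1,\dots,\mathbf{y}_s\}$ of $[X]$: $\phi(n_1\mathbf{y}_1+\cdots+n_s\mathbf{y}_s)=(n_1,\dots,n_s)$.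 For a linearly repetitive $X$ with $\mathbf{0}\in X$, $L:\mathbb{R}^n\to\mathbb{R}^s$ denotes the (unique) linear map with $\|\phi(\mathbf{x})-L(\mathbf{x})\|=o(\|\mathbf{x}\|)$ for $\mathbf{x}\in X$, $\|\mathbf{x}\|\to\infty$. Norms are Euclidean. *)

theory Defs
  imports
    "HOL-Analysis.Analysis"
    "HOL-Library.Landau_Symbols"
    "HOL-Computational_Algebra.Group_Closure"
begin

definition delone :: "'a::euclidean_space set \<Rightarrow> bool" where
  "delone X \<longleftrightarrow>
     (\<exists>r>0. \<exists>R>0. (\<forall>c. \<forall>x \<in> X \<inter> ball c r. \<forall>y \<in> X \<inter> ball c r. x = y) \<and>
                (\<forall>c. X \<inter> cball c R \<noteq> {}))"

definition centered_patch :: "'a::euclidean_space set \<Rightarrow> real \<Rightarrow> 'a \<Rightarrow> 'a set" where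
  "centered_patch X T x = (\<lambda>z. z - x) ` (X \<inter> cball x T)"

definition repetition_radius :: "'a::euclidean_space set \<Rightarrow> real \<Rightarrow> real \<Rightarrow> bool" where
  "repetition_radius X T M \<longleftrightarrow>
     M > 0 \<and> (\<forall>c. \<forall>y\<in>X. \<exists>x \<in> X \<inter> cball c M. centered_patch X T x = centered_patch X T y)"

definition repetitive :: "'a::euclidean_space set \<Rightarrow> bool" where
  "repetitive X \<longleftrightarrow> (\<forall>T>0. \<exists>M. repetition_radius X T M)"

text \<open>For a repetitive Delone set and \<open>T > 0\<close> the minimum is attained, see
  \<open>repetitivity_function\<close> below.\<close>

definition repetitivity_function :: "'a::euclidean_space set \<Rightarrow> real \<Rightarrow> real" where
  "repetitivity_function X T = (LEAST M. repetition_radius X T M)"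

definition linearly_repetitive :: "'a::euclidean_space set \<Rightarrow> bool" where
  "linearly_repetitive X \<longleftrightarrow>
     repetitive X \<and> repetitivity_function X \<in> O[at_top](\<lambda>T. T)"

definition int_basis :: "'a::real_vector set \<Rightarrow> nat \<Rightarrow> (nat \<Rightarrow> 'a) \<Rightarrow> bool" where
  "int_basis G s y \<longleftrightarrow>
     (\<forall>j<s. y j \<in> G) \<and>
     (\<forall>g\<in>G. \<exists>m::nat \<Rightarrow> int. g = (\<Sum>j<s. of_int (m j) *\<^sub>R y j)) \<and>
     (\<forall>m::nat \<Rightarrow> int. (\<Sum>j<s. of_int (m j) *\<^sub>R y j) = 0 \<longrightarrow> (\<forall>j<s. m j = 0))"

text \<open>Since the rank \<open>s\<close> depends on \<open>X\<close>, vectors of length \<open>s\<close> over the integers or the reals are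
  functions on \<open>nat\<close> of which only the entries with index below \<open>s\<close> are meaningful. Likewise,
  an address map is only meaningful on \<open>group_closure X\<close>, the additive group generated by \<open>X\<close>.\<close>

definition address_map ::
    "'a::euclidean_space set \<Rightarrow> nat \<Rightarrow> ('a \<Rightarrow> nat \<Rightarrow> int) \<Rightarrow> bool" where
  "address_map X s \<phi> \<longleftrightarrow>
     (\<exists>y. int_basis (group_closure X) s y \<and>
          (\<forall>m::nat \<Rightarrow> int. \<forall>i<s. \<phi> (\<Sum>j<s. of_int (m j) *\<^sub>R y j) i = m i))"

definition address_deviation ::
    "nat \<Rightarrow> ('a \<Rightarrow> nat \<Rightarrow> int) \<Rightarrow> ('a \<Rightarrow> nat \<Rightarrow> real) \<Rightarrow> 'a \<Rightarrow> real" where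
  "address_deviation s \<phi> L x = L2_set (\<lambda>i. of_int (\<phi> x i) - L x i) {..<s}"

definition associated_linear_map ::
    "'a::euclidean_space set \<Rightarrow> nat \<Rightarrow> ('a \<Rightarrow> nat \<Rightarrow> int) \<Rightarrow> ('a \<Rightarrow> nat \<Rightarrow> real) \<Rightarrow> bool" where
  "associated_linear_map X s \<phi> L \<longleftrightarrow>
     (\<forall>i<s. linear (\<lambda>x. L x i)) \<and>
     address_deviation s \<phi> L \<in> o[inf at_infinity (principal X)](norm)"

lemma repetition_radius_least_exists:
  fixes X :: "'a::euclidean_space set"
  assumes "delone X" and "\<exists>M. repetition_radius X T M"
  shows "\<exists>M. repetition_radius X T M \<and> (\<forall>M'. repetition_radius X T M' \<longrightarrow> M \<le> M')"
proof -
  obtain r R where r: "r > 0" and R: "R > 0"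
    and sep: "\<And>c x y. x \<in> X \<inter> ball c r \<Longrightarrow> y \<in> X \<inter> ball c r \<Longrightarrow> x = y"
    and dense: "\<And>c. X \<inter> cball c R \<noteq> {}"
    using assms(1) unfolding delone_def by metis
  have disc: "y = x" if "x \<in> X" "y \<in> X" "dist y x < r" for x y
    using sep[of x y y] that r by auto
  have fin: "finite (X \<inter> cball c t)" for c t
  proof (rule ccontr)
    assume "infinite (X \<inter> cball c t)"
    then obtain x where "x islimpt (X \<inter> cball c t)"
      using bounded_infinite_imp_islimpt[of "X \<inter> cball c t" "X \<inter> cball c t"]
      by (meson bounded_Int bounded_cball order_refl)
    moreover have "\<not> x islimpt (X \<inter> cball c t)"
      by (rule discrete_imp_not_islimpt[OF r]) (use disc in auto)
    ultimately show False by blast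
  qed
  define S where "S = {M. repetition_radius X T M}"
  have S_ne: "S \<noteq> {}" using assms(2) by (simp add: S_def)
  have S_pos: "0 < M" if "M \<in> S" for M using that by (simp add: S_def repetition_radius_def)
  have bdd: "bdd_below S" using S_pos by (meson bdd_belowI less_imp_le)
  have in_Inf: "\<exists>x \<in> X \<inter> cball c (Inf S). centered_patch X T x = centered_patch X T y"
    if y: "y \<in> X" for c y
  proof -
    define A where "A = {x \<in> X. centered_patch X T x = centered_patch X T y}"
    have A_S: "\<exists>x\<in>A. dist c x \<le> M" if "M \<in> S" for M
      using that y unfolding S_def repetition_radius_def A_def by fastforce
    obtain M0 where M0: "M0 \<in> S" using S_ne by blast
    define F where "F = A \<inter> cball c M0"
    have "finite F" using fin[of c M0] by (rule finite_subset[rotated]) (auto simp: F_def A_def)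
    moreover have "F \<noteq> {}" using A_S[OF M0] by (auto simp: F_def)
    ultimately obtain x where x: "x \<in> F" and min: "\<And>z. z \<in> F \<Longrightarrow> dist c x \<le> dist c z"
      using arg_min_if_finite(1) arg_min_least by metis
    have "dist c x \<le> M" if M: "M \<in> S" for M
    proof -
      obtain z where z: "z \<in> A" "dist c z \<le> M" using A_S[OF M] by blast
      show ?thesis
      proof (cases "z \<in> F")
        case True
        then show ?thesis using min z(2) by force
      next
        case False
        then show ?thesis using z x by (auto simp: F_def)
      qed
    qed
    then have "dist c x \<le> Inf S" using S_ne by (intro cInf_greatest) auto
    then show ?thesis using x by (auto simp: F_def A_def)
  qed
  have "Inf S \<noteq> 0"
  proof
    assume 0: "Inf S = 0"
    obtain y where y: "y \<in> X" using dense by blast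
    have all: "c \<in> X" for c using in_Inf[OF y, of c] 0 by auto
    obtain b :: 'a where b: "norm b = r / 2"
      using vector_choose_size[of "r / 2"] r by auto
    have "b = 0" by (rule disc) (use all b r in auto)
    then show False using b r by simp
  qed
  moreover have "0 \<le> Inf S" using S_ne S_pos by (intro cInf_greatest) (auto intro: less_imp_le)
  ultimately have "repetition_radius X T (Inf S)"
    using in_Inf by (simp add: repetition_radius_def)
  moreover have "Inf S \<le> M'" if "repetition_radius X T M'" for M'
    using that bdd by (intro cInf_lower) (auto simp: S_def)
  ultimately show ?thesis by blast
qed

lemma repetitivity_function:
  fixes X :: "'a::euclidean_space set"
  assumes "delone X" and "repetitive X" and "T > 0"
  shows "repetition_radius X T (repetitivity_function X T)"
    and "repetition_radius X T M \<Longrightarrow> repetitivity_function X T \<le> M"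
proof -
  obtain M0 where M0: "repetition_radius X T M0" "\<And>M'. repetition_radius X T M' \<Longrightarrow> M0 \<le> M'"
    using repetition_radius_least_exists[of X T] assms unfolding repetitive_def by metis
  have eq: "repetitivity_function X T = M0"
    unfolding repetitivity_function_def by (rule Least_equality) (use M0 in auto)
  show "repetition_radius X T (repetitivity_function X T)" using M0 eq by simp
  show "repetitivity_function X T \<le> M" if "repetition_radius X T M" using M0 eq that by simp
qed

end

theory Submission
  imports Defs
begin

text \<open>The sign sequence that is fixed by the substitution \<open>+ \<mapsto> + - + +\<close>, \<open>- \<mapsto> - + - -\<close> is
  linearly recurrent, while the second eigenvalue 2 of the substitution matrix exceeds 1: the excess
  of plus signs among the first \<open>4 ^ k\<close> letters is \<open>2 ^ k\<close>. Replacing the letters by intervals of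
  the rationally independent lengths \<open>1 + sqrt 2\<close> and \<open>1\<close> turns the numbers of letters into
  address coordinates and the excess into the deviation of the address from its linear part.
  Integer coordinates in the remaining directions give the set in higher dimensions.\<close>

section \<open>A sign sequence with large discrepancy\<close>

text \<open>The substitution sends a letter e to e times the pattern + - + +; this is the sign at
  position r of the pattern.\<close>

definition block_sign :: "int \<Rightarrow> int" where
  "block_sign r = (if r = 1 then - 1 else 1)"

text \<open>The two-sided fixed point is read off base-4 digits. Division by 4 rounds down and
  decreases the absolute value except at 0 and -1, which it fixes; so both need a seed
  letter.\<close>

function word :: "int \<Rightarrow> int" where
  "word n = (if n = 0 \<or> n = - 1 then 1 else block_sign (n mod 4) * word (n div 4))"
  by auto
termination by (relation "Wellfounded.measure (\<lambda>n. nat \<bar>n\<bar>)") auto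

declare word.simps [simp del]

lemma word_0 [simp]: "word 0 = 1"
  by (simp add: word.simps [of 0])

text \<open>Away from the seeds this is the recursion. The seeds 0 and -1 end in the digits 0 and 3,
  whose block sign is 1, so they satisfy it too.\<close>

lemma word_inflate:
  assumes "0 \<le> r" "r < 4"
  shows "word (4 * n + r) = block_sign r * word n"
proof -
  have "(4 * n + r) mod 4 = r" "(4 * n + r) div 4 = n" using assms by auto
  moreover have "n = 0 \<and> r = 0" if "4 * n + r = 0" using assms that by presburger
  moreover have "n = - 1 \<and> r = 3" if "4 * n + r = - 1" using assms that by presburger
  ultimately show ?thesis
    by (auto simp: word.simps [of "4 * n + r"] word.simps [of "-1"] word.simps [of 0] block_sign_def)
qed

lemma word_mult_4 [simp]: "word (4 * n) = word n"
  using word_inflate [of 0 n] by (simp add: block_sign_def)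

lemma word_pm1: "word n = 1 \<or> word n = - 1"
  by (induction n rule: word.induct) (subst (1 2) word.simps, auto simp: block_sign_def)

text \<open>The \<open>k\<close>-fold image of a letter is that letter times one fixed block of
  length \<open>4 ^ k\<close>. The induction peels off the lowest base-4 digit of
  \<open>r\<close>.\<close>

lemma word_block:
  assumes "0 \<le> r" "r < 4 ^ k"
  shows "word (4 ^ k * n + r) = word n * word r"
  using assms
proof (induction k arbitrary: r)
  case (Suc k)
  have rk: "0 \<le> r div 4" "r div 4 < 4 ^ k" using Suc.prems by auto
  have e: "4 ^ Suc k * n + r = 4 * (4 ^ k * n + r div 4) + r mod 4" by simp
  have "word (4 ^ Suc k * n + r) = block_sign (r mod 4) * word (4 ^ k * n + r div 4)"
    unfolding e by (rule word_inflate) auto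
  also have "\<dots> = word n * (block_sign (r mod 4) * word (r div 4))"
    using Suc.IH [OF rk] by simp
  also have "block_sign (r mod 4) * word (r div 4) = word r"
    using word_inflate [of "r mod 4" "r div 4"] by simp
  finally show ?case .
next
  case 0
  then have "r = 0" by simp
  then show ?case by simp
qed

text \<open>A block of length 16 is \<open>word q\<close> times a word that begins + - + + - + - -.
  There the four sign pairs start at 0, 1, 2 and 6, and a global sign change only permutes them. The
  bound 14 keeps both letters in the block.\<close>

lemma word_pairs_in_16_block:
  assumes s: "s = 1 \<or> s = - 1" and t: "t = 1 \<or> t = - 1"
  shows "\<exists>r\<ge>0. r \<le> 14 \<and> word (16 * q + r) = s \<and> word (16 * q + r + 1) = t"
proof -
  have *: "word (16 * q + r) = word q * word r" if "0 \<le> r" "r < 16" for r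
    using word_block [of r 2 q] that by simp
  have "word 1 = - 1" "word 2 = 1" "word 3 = 1"
    using word_inflate [of 1 0] word_inflate [of 2 0] word_inflate [of 3 0]
    by (simp_all add: block_sign_def)
  then have vals: "word 1 = - 1" "word 2 = 1" "word 3 = 1" "word 6 = - 1" "word 7 = - 1"
    using word_inflate [of 2 1] word_inflate [of 3 1] by (simp_all add: block_sign_def)
  have pairs: "word (16 * q + 0) = word q" "word (16 * q + 0 + 1) = - word q"
    "word (16 * q + 1) = - word q" "word (16 * q + 1 + 1) = word q"
    "word (16 * q + 2) = word q" "word (16 * q + 2 + 1) = word q"
    "word (16 * q + 6) = - word q" "word (16 * q + 6 + 1) = - word q"
    unfolding add.assoc using *[of 0] by (simp_all add: * vals)
  have "s = word q \<or> s = - word q" "t = word q \<or> t = - word q"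
    using s t word_pm1 [of q] by auto
  then consider "s = word q" "t = - word q" | "s = - word q" "t = word q"
    | "s = word q" "t = word q" | "s = - word q" "t = - word q"
    by blast
  then show ?thesis
  proof cases
    case 1
    then show ?thesis by (intro exI [of _ 0] conjI) (unfold pairs, auto)
  next
    case 2
    then show ?thesis by (intro exI [of _ 1] conjI) (unfold pairs, auto)
  next
    case 3
    then show ?thesis by (intro exI [of _ 2] conjI) (unfold pairs, auto)
  next
    case 4
    then show ?thesis by (intro exI [of _ 6] conjI) (unfold pairs, auto)
  qed
qed

text \<open>A window of length \<open>2 t + 1 \<le> 4 ^ k\<close> meets at most two consecutive blocks of length \<open>4 ^ k\<close>,
  and these are determined by the corresponding pair of letters.\<close>

lemma word_window_recurrence:
  assumes t: "0 \<le> t" "2 * t + 1 \<le> 4 ^ k"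
  shows "\<exists>m'. \<bar>m' - c\<bar> \<le> 17 * 4 ^ k \<and> (\<forall>i. \<bar>i\<bar> \<le> t \<longrightarrow> word (m' + i) = word (m + i))"
proof -
  define N :: int where "N = 4 ^ k"
  have N: "N > 0" "2 * t + 1 \<le> N" using t by (simp_all add: N_def)
  \<comment> \<open>The left end \<open>m - t\<close> of the window lies in block number
    \<open>n\<close> of length \<open>N\<close>, at offset \<open>u\<close>; the position
    \<open>c\<close> lies in superblock \<open>q\<close> of length \<open>16 * N\<close>, at offset
    \<open>v\<close>.\<close>
  define n where "n = (m - t) div N"
  define u where "u = m - t - N * n"
  have u: "0 \<le> u" "u < N"
    using N by (simp_all add: u_def n_def minus_mult_div_eq_mod)
  define q where "q = c div (16 * N)"
  define v where "v = c - 16 * N * q"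
  have v: "0 \<le> v" "v < 16 * N"
    using N by (simp_all add: v_def q_def minus_mult_div_eq_mod)
  obtain r where r: "0 \<le> r" "r \<le> 14"
    "word (16 * q + r) = word n" "word (16 * q + r + 1) = word (n + 1)"
    using word_pairs_in_16_block [OF word_pm1 [of n] word_pm1 [of "n + 1"], of q] by blast
  define n' where "n' = 16 * q + r"
  \<comment> \<open>Moving by a whole number of blocks keeps the offset \<open>u\<close>, so the two
    windows meet their blocks in the same way.\<close>
  define m' where "m' = m + N * (n' - n)"
  have m'_c: "m' - c = u + t + N * r - v"
    by (simp add: m'_def n'_def u_def v_def algebra_simps)
  have "0 \<le> N * r" "N * r \<le> N * 14" using r N by (auto intro: mult_left_mono)
  then have "\<bar>m' - c\<bar> \<le> 17 * N" unfolding m'_c using u v t N by linarith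
  moreover have "word (m' + i) = word (m + i)" if i: "\<bar>i\<bar> \<le> t" for i
  proof -
    define z where "z = u + t + i"
    \<comment> \<open>The window starts at an offset below \<open>N\<close> and has length at most
      \<open>N\<close>, so it ends before a third block.\<close>
    have z: "0 \<le> z" "z < 2 * N" using u i t N by (auto simp: z_def)
    have e: "m + i = N * n + z" "m' + i = N * n' + z"
      by (simp_all add: z_def u_def m'_def algebra_simps)
    show ?thesis
    proof (cases "z < N")
      case True
      then show ?thesis unfolding e using word_block [of z k] z r by (simp add: N_def n'_def)
    next
      case False
      then have z': "0 \<le> z - N" "z - N < N" using z by auto
      have e': "N * n + z = N * (n + 1) + (z - N)" "N * n' + z = N * (n' + 1) + (z - N)"
        by (simp_all add: algebra_simps)
      show ?thesis unfolding e e'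
        using word_block [of "z - N" k] z' r by (simp add: N_def n'_def)
    qed
  qed
  ultimately show ?thesis unfolding N_def by blast
qed

section \<open>Counting plus signs and the growth of the discrepancy\<close>

definition letter :: "int \<Rightarrow> int" where
  "letter n = (if word n = 1 then 1 else 0)"

text \<open>The count is signed, negative to the left of 0, so that one step formula holds on all
  integers.\<close>

definition plus_count :: "int \<Rightarrow> int" where
  "plus_count n = (\<Sum>i\<in>{0..<n}. letter i) - (\<Sum>i\<in>{n..<0}. letter i)"

text \<open>Plus signs minus minus signs, that is, the signed partial sum of
  \<open>word\<close>.\<close>

definition discrepancy :: "int \<Rightarrow> int" where
  "discrepancy n = 2 * plus_count n - n"

lemma letter_bounds: "0 \<le> letter n" "letter n \<le> 1"
  by (auto simp: letter_def)

lemma plus_count_0 [simp]: "plus_count 0 = 0"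
  by (simp add: plus_count_def)

lemma plus_count_step: "plus_count (n + 1) = plus_count n + letter n"
proof (cases "0 \<le> n")
  case True
  then have "{0..<n + 1} = insert n {0..<n}" by auto
  with True show ?thesis by (simp add: plus_count_def)
next
  case False
  then have "{n..<0} = insert n {n + 1..<0}" by auto
  with False show ?thesis by (simp add: plus_count_def)
qed

lemma discrepancy_step: "discrepancy (n + 1) = discrepancy n + word n"
  using word_pm1 [of n] by (auto simp: discrepancy_def plus_count_step letter_def)

lemma discrepancy_0 [simp]: "discrepancy 0 = 0"
  by (simp add: discrepancy_def)

text \<open>The partial sums of the pattern + - + + are 1, 0, 1, 2.\<close>

lemma discrepancy_within_block:
  "discrepancy (4 * n + 1) = discrepancy (4 * n) + word n"
  "discrepancy (4 * n + 2) = discrepancy (4 * n)"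
  "discrepancy (4 * n + 3) = discrepancy (4 * n) + word n"
  "discrepancy (4 * n + 4) = discrepancy (4 * n) + 2 * word n"
  using discrepancy_step [of "4 * n"] discrepancy_step [of "4 * n + 1"]
    discrepancy_step [of "4 * n + 2"] discrepancy_step [of "4 * n + 3"]
    word_inflate [of 1 n] word_inflate [of 2 n] word_inflate [of 3 n]
  by (simp_all add: block_sign_def add.commute)

text \<open>Each inflated letter sums to twice the letter: this is the eigenvalue 2 of the
  substitution. The induction runs from 0 in both directions.\<close>

lemma discrepancy_mult_4: "discrepancy (4 * n) = 2 * discrepancy n"
proof (induction n rule: int_induct [where k = 0])
  case (step1 n)
  then show ?case
    using discrepancy_within_block(4) [of n] discrepancy_step [of n] by (simp add: distrib_left)
next
  case (step2 n)
  then show ?case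
    using discrepancy_within_block(4) [of "n - 1"] discrepancy_step [of "n - 1"]
    by (simp add: right_diff_distrib)
qed simp

text \<open>Each factor 4 doubles the initial value 1, so along powers of 4 the discrepancy is the
  square root of its argument.\<close>

lemma discrepancy_power_4: "discrepancy (4 ^ k) = 2 ^ k"
proof (induction k)
  case 0
  then show ?case using discrepancy_step [of 0] by simp
next
  case (Suc k)
  then show ?case using discrepancy_mult_4 [of "4 ^ k"] by simp
qed

text \<open>At the start of a block the discrepancy is exactly doubled, and at the next three
  positions it differs from that value by at most 1.\<close>

lemma discrepancy_inflate_le:
  assumes "0 \<le> r" "r < 4"
  shows "\<bar>discrepancy (4 * n + r)\<bar> \<le> 2 * \<bar>discrepancy n\<bar> + 1"
proof -
  have "r = 0 \<or> r = 1 \<or> r = 2 \<or> r = 3" using assms by presburger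
  then show ?thesis
    using discrepancy_within_block [of n] discrepancy_mult_4 [of n] word_pm1 [of n] by auto
qed

text \<open>Inflation by 4 only doubles the discrepancy, so each inflation halves the slope of a linear
  bound.\<close>

lemma discrepancy_le_linear_halving:
  "\<exists>B::real. \<forall>n. \<bar>of_int (discrepancy n)\<bar> \<le> (1 / 2) ^ l * \<bar>of_int n\<bar> + B"
proof (induction l)
  case 0
  have "\<bar>discrepancy n\<bar> \<le> \<bar>n\<bar>" for n
  proof (induction n rule: int_induct [where k = 0])
    case (step1 n)
    then show ?case using discrepancy_step [of n] word_pm1 [of n] by auto
  next
    case (step2 n)
    then show ?case using discrepancy_step [of "n - 1"] word_pm1 [of "n - 1"] by auto
  qed simp
  then have "\<bar>real_of_int (discrepancy n)\<bar> \<le> \<bar>real_of_int n\<bar>" for n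
    by (metis of_int_abs of_int_le_iff)
  then show ?case by (intro exI [of _ 0]) simp
next
  case (Suc l)
  define A :: real where "A = (1 / 2) ^ l"
  from Suc obtain B where B: "\<bar>real_of_int (discrepancy n)\<bar> \<le> A * \<bar>of_int n\<bar> + B" for n
    unfolding A_def by blast
  have A: "0 \<le> A" by (simp add: A_def)
  \<comment> \<open>With \<open>n = m div 4\<close>, the inequality
    \<open>4 * \<bar>n\<bar> \<le> \<bar>m\<bar> + 3\<close> yields the slope \<open>A / 2\<close>
    and the error \<open>3 / 2 * A\<close>; the rest is the doubled error \<open>2 * B\<close> and
    the 1 from inflation.\<close>
  have "\<bar>real_of_int (discrepancy m)\<bar> \<le> (1 / 2) ^ Suc l * \<bar>of_int m\<bar> + (3 / 2 * A + 2 * B + 1)" for m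
  proof -
    define n where "n = m div 4"
    have m: "m = 4 * n + m mod 4" by (simp add: n_def)
    have "\<bar>discrepancy m\<bar> \<le> 2 * \<bar>discrepancy n\<bar> + 1"
      using discrepancy_inflate_le [of "m mod 4" n] m by simp
    then have 1: "\<bar>real_of_int (discrepancy m)\<bar> \<le> 2 * \<bar>real_of_int (discrepancy n)\<bar> + 1" by linarith
    have "4 * \<bar>n\<bar> \<le> \<bar>m\<bar> + 3" unfolding n_def by presburger
    then have "4 * \<bar>real_of_int n\<bar> \<le> \<bar>real_of_int m\<bar> + 3" by linarith
    then have 2: "2 * (A * \<bar>real_of_int n\<bar>) \<le> A / 2 * \<bar>real_of_int m\<bar> + 3 / 2 * A"
      using mult_left_mono [OF _ A, of "4 * \<bar>real_of_int n\<bar>" "\<bar>real_of_int m\<bar> + 3"]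
      by (simp add: algebra_simps)
    have "(1 / 2) ^ Suc l * \<bar>real_of_int m\<bar> = A / 2 * \<bar>real_of_int m\<bar>" by (simp add: A_def)
    with 1 2 B [of n] show ?thesis by linarith
  qed
  then show ?case by blast
qed

text \<open>Enough halvings bring the slope below \<open>e\<close>. This is the little-o estimate
  behind the associated linear map.\<close>

lemma discrepancy_sublinear:
  assumes "e > 0"
  shows "\<exists>B. \<forall>n. \<bar>real_of_int (discrepancy n)\<bar> \<le> e * \<bar>real_of_int n\<bar> + B"
proof -
  obtain l where "(1 / 2 :: real) ^ l < e"
    using real_arch_pow_inv [OF assms, of "1 / 2"] by auto
  moreover obtain B where "\<forall>n. \<bar>real_of_int (discrepancy n)\<bar> \<le> (1 / 2) ^ l * \<bar>real_of_int n\<bar> + B"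
    using discrepancy_le_linear_halving by blast
  ultimately have "\<bar>real_of_int (discrepancy n)\<bar> \<le> e * \<bar>real_of_int n\<bar> + B" for n
    by (meson abs_ge_zero add_right_mono less_imp_le mult_right_mono order_trans)
  then show ?thesis by blast
qed

section \<open>The points on the line\<close>

text \<open>Left endpoint of interval number \<open>n\<close>: every letter contributes length 1 and
  every plus sign a further \<open>sqrt 2\<close>.\<close>

definition point :: "int \<Rightarrow> real" where
  "point n = of_int n + sqrt 2 * of_int (plus_count n)"

lemma point_0 [simp]: "point 0 = 0"
  by (simp add: point_def)

lemma sqrt2_bounds: "1 < sqrt 2" "sqrt 2 < (2::real)"
  using real_sqrt_less_iff [of 2 4] by simp_all

lemma plus_count_diff_bounds:
  assumes "m \<le> n"
  shows "plus_count m \<le> plus_count n" "plus_count n - plus_count m \<le> n - m"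
proof -
  have "plus_count m \<le> plus_count n \<and> plus_count n - plus_count m \<le> n - m"
    using assms
  proof (induction n rule: int_ge_induct)
    case (step i)
    then show ?case using plus_count_step [of i] letter_bounds [of i] by auto
  qed simp
  then show "plus_count m \<le> plus_count n" "plus_count n - plus_count m \<le> n - m" by auto
qed

text \<open>Every interval has length 1 or \<open>1 + sqrt 2\<close>, hence between 1 and 3. This
  converts distances of points into distances of indices and back.\<close>

lemma point_diff_bounds:
  "\<bar>of_int m - of_int n\<bar> \<le> \<bar>point m - point n\<bar>" (is ?lower)
  "\<bar>point m - point n\<bar> \<le> 3 * \<bar>of_int m - of_int n\<bar>" (is ?upper)
proof -
  have *: "of_int b - of_int a \<le> point b - point a \<and> point b - point a \<le> 3 * (of_int b - of_int a)"
    if "a \<le> b" for a b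
  proof -
    define d where "d = real_of_int (plus_count b) - of_int (plus_count a)"
    have d: "0 \<le> d" "d \<le> of_int b - of_int a"
      using plus_count_diff_bounds [OF that] unfolding d_def by linarith+
    have "point b - point a = of_int b - of_int a + sqrt 2 * d"
      by (simp add: point_def d_def algebra_simps)
    moreover have "0 \<le> sqrt 2 * d" "sqrt 2 * d \<le> 2 * d"
      using d sqrt2_bounds by (simp, intro mult_right_mono) auto
    ultimately show ?thesis using d by argo
  qed
  have "?lower \<and> ?upper"
  proof (cases "m \<le> n")
    case True
    then show ?thesis using *[of m n] by auto
  next
    case False
    then show ?thesis using *[of n m] by auto
  qed
  then show ?lower ?upper by auto
qed

text \<open>After bracketing \<open>c\<close> between \<open>point (- N)\<close> and
  \<open>point N\<close>, a discrete intermediate value argument finds the interval containing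
  \<open>c\<close>, and its length is at most 3.\<close>

lemma point_near: "\<exists>n. \<bar>point n - c\<bar> \<le> 3"
proof -
  define N where "N = \<lceil>\<bar>c\<bar>\<rceil>"
  have N: "0 \<le> N" "\<bar>c\<bar> \<le> of_int N" by (auto simp: N_def)
  have "point (- N) \<le> c"
  proof -
    have "plus_count (- N) \<le> 0" using plus_count_diff_bounds(1) [of "- N" 0] N by simp
    then have "sqrt 2 * real_of_int (plus_count (- N)) \<le> 0" by (simp add: mult_le_0_iff)
    then show ?thesis using N by (simp add: point_def)
  qed
  moreover have "c \<le> point N"
  proof -
    have "0 \<le> plus_count N" using plus_count_diff_bounds(1) [of 0 N] N by simp
    then have "0 \<le> sqrt 2 * real_of_int (plus_count N)" by simp
    then show ?thesis using N unfolding point_def by linarith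
  qed
  moreover have "\<exists>n. point n \<le> c \<and> c \<le> point (n + 1)"
    if "a \<le> b" "point a \<le> c" "c \<le> point b" for a b
    using that
  proof (induction b rule: int_ge_induct)
    case base
    have "point a \<le> point (a + 1)"
      using letter_bounds [of a] by (simp add: point_def plus_count_step distrib_left)
    with base show ?case by (intro exI [of _ a]) auto
  next
    case (step i)
    then show ?case by (cases "c \<le> point i") (auto intro: exI [of _ i])
  qed
  moreover have "- N \<le> N" using N(1) by simp
  ultimately have "\<exists>n. point n \<le> c \<and> c \<le> point (n + 1)" by blast
  then obtain n where "point n \<le> c" "c \<le> point (n + 1)" by blast
  then show ?thesis using point_diff_bounds(2) [of "n + 1" n] by (intro exI [of _ n]) auto
qed

lemma plus_count_diff_cong:
  assumes w: "\<And>i. \<bar>i\<bar> \<le> t \<Longrightarrow> word (m' + i) = word (m + i)" and i: "\<bar>i\<bar> \<le> t"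
  shows "plus_count (m' + i) - plus_count m' = plus_count (m + i) - plus_count m"
  using i
proof (induction i rule: int_induct [where k = 0])
  case (step1 i)
  then show ?case
    using w [of i] plus_count_step [of "m + i"] plus_count_step [of "m' + i"]
    by (simp add: letter_def add.assoc)
next
  case (step2 i)
  then show ?case
    using w [of "i - 1"] plus_count_step [of "m + (i - 1)"] plus_count_step [of "m' + (i - 1)"]
    by (simp add: letter_def)
qed simp

text \<open>Distinct indices are no farther apart than their points, so a point within
  \<open>t\<close> of \<open>point m\<close> has its index in the window, where equal letters give
  equal relative positions.\<close>

lemma range_point_window:
  assumes w: "\<And>i. \<bar>i\<bar> \<le> t \<Longrightarrow> word (m' + i) = word (m + i)" and z: "\<bar>z\<bar> \<le> of_int t"
    and "point m + z \<in> range point"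
  shows "point m' + z \<in> range point"
proof -
  obtain l where l: "point m + z = point l" using assms(3) by auto
  have "\<bar>real_of_int l - of_int m\<bar> \<le> of_int t"
    using point_diff_bounds(1) [of l m] l z by simp
  then have "\<bar>l - m\<bar> \<le> t" by linarith
  from plus_count_diff_cong [OF w this]
  have "plus_count (m' + (l - m)) = plus_count m' + (plus_count l - plus_count m)" by simp
  then have "point (m' + (l - m)) = point m' + (point l - point m)"
    unfolding point_def by (simp add: right_diff_distrib distrib_left)
  then have "point m' + z = point (m' + (l - m))" using l by simp
  then show ?thesis by simp
qed

text \<open>A block length \<open>4 ^ k\<close> within a factor 4 of the window length
  \<open>2 * t + 1\<close> makes the return distance \<open>17 * 4 ^ k\<close> linear in
  \<open>T\<close>.\<close>

lemma point_recurrence: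
  assumes "T > 0"
  shows "\<exists>m'. \<bar>point m' - c\<bar> \<le> 408 * T + 615 \<and>
    (\<forall>z. \<bar>z\<bar> \<le> T \<longrightarrow> (point m' + z \<in> range point \<longleftrightarrow> point m + z \<in> range point))"
proof -
  define t where "t = \<lceil>T\<rceil>"
  have t: "0 \<le> t" "T \<le> of_int t" "of_int t \<le> T + 1" using assms by (auto simp: t_def)
  obtain j where j: "4 ^ j \<le> nat (2 * t + 1)" "nat (2 * t + 1) < 4 ^ (j + 1)"
    using ex_power_ivl1 [of 4 "nat (2 * t + 1)"] t by (auto simp del: power_Suc simp: Suc_le_eq)
  define k where "k = j + 1"
  have "int (nat (2 * t + 1)) < int (4 ^ (j + 1))" "int (4 ^ j) \<le> int (nat (2 * t + 1))"
    using j by (simp_all only: of_nat_less_iff of_nat_le_iff)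
  then have k: "2 * t + 1 \<le> 4 ^ k" "4 ^ k \<le> 4 * (2 * t + 1)"
    using t by (simp_all add: k_def)
  obtain c' where c': "\<bar>point c' - c\<bar> \<le> 3" using point_near by blast
  obtain m' where m': "\<bar>m' - c'\<bar> \<le> 17 * 4 ^ k" "\<And>i. \<bar>i\<bar> \<le> t \<Longrightarrow> word (m' + i) = word (m + i)"
    using word_window_recurrence [OF t(1) k(1)] by blast
  \<comment> \<open>The index distance is at most \<open>136 * t + 68\<close>, hence
    \<open>136 * T + 204\<close>. Intervals of length at most 3 turn this into
    \<open>408 * T + 612\<close>, and replacing \<open>c\<close> by \<open>point c'\<close> costs
    another 3.\<close>
  have "17 * 4 ^ k \<le> 17 * (4 * (2 * t + 1))" using k(2) by (intro mult_left_mono) auto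
  then have "\<bar>m' - c'\<bar> \<le> 136 * t + 68" using m'(1) by simp
  then have "\<bar>real_of_int m' - of_int c'\<bar> \<le> 136 * T + 204" using t by linarith
  then have "\<bar>point m' - point c'\<bar> \<le> 408 * T + 612"
    using point_diff_bounds(2) [of m' c'] by simp
  then have "\<bar>point m' - c\<bar> \<le> 408 * T + 615" using c' by (simp add: abs_le_iff)
  moreover have "point m' + z \<in> range point \<longleftrightarrow> point m + z \<in> range point" if "\<bar>z\<bar> \<le> T" for z
    using range_point_window [of t m' m z] range_point_window [of t m m' z] m'(2) that t by auto
  ultimately show ?thesis by blast
qed

section \<open>The Delone set\<close>

text \<open>In all directions but \<open>k\<close> the set is periodic with integer periods, so
  every property reduces to the coordinate \<open>k\<close>.\<close>

definition layered_set :: "'n::finite \<Rightarrow> (real ^ 'n) set" where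
  "layered_set k = {x. x $ k \<in> range point \<and> (\<forall>i. i \<noteq> k \<longrightarrow> x $ i \<in> \<int>)}"

lemma norm_le_card_mult:
  fixes x :: "real ^ 'n"
  assumes "\<And>i. \<bar>x $ i\<bar> \<le> B"
  shows "norm x \<le> real CARD('n) * B"
  using norm_le_l1_cart [of x] sum_bounded_above [of UNIV "\<lambda>i. \<bar>x $ i\<bar>" B] assms by auto

lemma layered_set_separated:
  assumes "x \<in> layered_set k" "y \<in> layered_set k" "x \<noteq> y"
  shows "1 \<le> dist x y"
proof -
  obtain i where i: "x $ i \<noteq> y $ i" using assms(3) by (auto simp: vec_eq_iff)
  have "1 \<le> \<bar>x $ i - y $ i\<bar>"
  proof (cases "i = k")
    case True
    then obtain m n where mn: "x $ i = point m" "y $ i = point n"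
      using assms by (auto simp: layered_set_def)
    with i have "m \<noteq> n" by metis
    then have "1 \<le> \<bar>m - n\<bar>" by linarith
    then have "1 \<le> \<bar>real_of_int m - of_int n\<bar>" by linarith
    then show ?thesis using point_diff_bounds(1) [of m n] mn by simp
  next
    case False
    then show ?thesis using assms i by (intro Ints_nonzero_abs_ge1) (auto simp: layered_set_def)
  qed
  also have "\<dots> \<le> dist x y"
    using component_le_norm_cart [of "x - y" i] by (simp add: dist_norm)
  finally show ?thesis .
qed

text \<open>Completing a given point of the line by rounding the other coordinates of
  \<open>c\<close> costs at most 1/2 in each of them. It serves both relative density and
  repetitivity.\<close>

lemma layered_set_near:
  fixes c :: "real ^ 'n"
  assumes "\<bar>point m - c $ k\<bar> \<le> B" "1 \<le> B"
  shows "\<exists>x\<in>layered_set k. x $ k = point m \<and> dist c x \<le> real CARD('n) * B"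
proof -
  define x :: "real ^ 'n" where "x = (\<chi> i. if i = k then point m else of_int (round (c $ i)))"
  have "\<bar>(c - x) $ i\<bar> \<le> B" for i
    using assms of_int_round_abs_le [of "c $ i"] by (auto simp: x_def abs_minus_commute)
  then have "dist c x \<le> real CARD('n) * B" unfolding dist_norm by (rule norm_le_card_mult)
  moreover have "x \<in> layered_set k" "x $ k = point m" by (auto simp: x_def layered_set_def)
  ultimately show ?thesis by blast
qed

lemma delone_layered_set: "delone (layered_set k)"
  unfolding delone_def
proof (intro exI conjI allI ballI)
  \<comment> \<open>Two points in an open ball of radius 1/2 have distance below 1, the separation
    constant; the 3 of the second radius comes from \<open>point_near\<close>.\<close>
  show "0 < (1 / 2 :: real)" by simp
  show "0 < real CARD('a) * 3" by simp
  show "x = y" if "x \<in> layered_set k \<inter> ball c (1 / 2)" "y \<in> layered_set k \<inter> ball c (1 / 2)" for c x y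
    using that layered_set_separated [of x k y] dist_triangle3 [of x y c] by force
  show "layered_set k \<inter> cball c (real CARD('a) * 3) \<noteq> {}" for c
  proof -
    obtain n where "\<bar>point n - c $ k\<bar> \<le> 3" using point_near by blast
    from layered_set_near [OF this] show ?thesis by auto
  qed
qed

text \<open>Moving a patch from \<open>x\<close> to \<open>y\<close> shifts the other coordinates by
  integers, so only the coordinate \<open>k\<close> can matter. The hypothesis is symmetric in
  \<open>x\<close> and \<open>y\<close>, which gives equality of patches later.\<close>

lemma layered_set_patch_subset:
  assumes "x \<in> layered_set k" "y \<in> layered_set k"
    and "\<And>z. \<bar>z\<bar> \<le> T \<Longrightarrow> x $ k + z \<in> range point \<longleftrightarrow> y $ k + z \<in> range point"
  shows "centered_patch (layered_set k) T x \<subseteq> centered_patch (layered_set k) T y"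
proof
  fix z assume "z \<in> centered_patch (layered_set k) T x"
  then have z: "x + z \<in> layered_set k" "norm z \<le> T"
    by (auto simp: centered_patch_def dist_norm norm_minus_commute)
  have "\<bar>z $ k\<bar> \<le> T" using z component_le_norm_cart [of z k] by linarith
  then have "y $ k + z $ k \<in> range point" using z assms(3) by (simp add: layered_set_def)
  moreover have "y $ i + z $ i \<in> \<int>" if "i \<noteq> k" for i
  proof -
    have "y $ i + ((x + z) $ i - x $ i) \<in> \<int>"
      using z assms that by (intro Ints_add Ints_diff) (auto simp: layered_set_def)
    then show ?thesis by simp
  qed
  ultimately have "y + z \<in> layered_set k" by (simp add: layered_set_def)
  moreover have "y + z \<in> cball y T" using z by (simp add: dist_norm)
  ultimately show "z \<in> centered_patch (layered_set k) T y"
    unfolding centered_patch_def by (intro image_eqI [of _ _ "y + z"]) auto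
qed

lemma repetition_radius_layered_set:
  fixes k :: "'n::finite"
  assumes "T > 0"
  shows "repetition_radius (layered_set k) T (real CARD('n) * (408 * T + 615))"
  unfolding repetition_radius_def
proof (intro conjI allI ballI)
  show "0 < real CARD('n) * (408 * T + 615)" using assms by simp
  fix c y :: "real ^ 'n"
  assume y: "y \<in> layered_set k"
  then obtain m where m: "y $ k = point m" by (auto simp: layered_set_def)
  obtain m' where m': "\<bar>point m' - c $ k\<bar> \<le> 408 * T + 615"
    "\<And>z. \<bar>z\<bar> \<le> T \<Longrightarrow> point m' + z \<in> range point \<longleftrightarrow> point m + z \<in> range point"
    using point_recurrence [OF assms] by blast
  obtain x where x: "x \<in> layered_set k" "x $ k = point m'"
    "dist c x \<le> real CARD('n) * (408 * T + 615)"
    using layered_set_near [OF m'(1)] assms by auto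
  have "centered_patch (layered_set k) T x = centered_patch (layered_set k) T y"
    by (intro equalityI layered_set_patch_subset) (use x y m m'(2) in auto)
  then show "\<exists>x\<in>layered_set k \<inter> cball c (real CARD('n) * (408 * T + 615)).
      centered_patch (layered_set k) T x = centered_patch (layered_set k) T y"
    using x by auto
qed

lemma linearly_repetitive_layered_set: "linearly_repetitive (layered_set (k :: 'n::finite))"
proof -
  let ?X = "layered_set k"
  have rep: "repetitive ?X"
    unfolding repetitive_def using repetition_radius_layered_set by blast
  \<comment> \<open>For \<open>T \<ge> 1\<close> the constant 615 is absorbed: 408 + 615 =
    1023.\<close>
  have "norm (repetitivity_function ?X T) \<le> (real CARD('n) * 1023) * norm T" if "T \<ge> 1" for T
  proof -
    have T: "T > 0" using that by simp
    note fn = repetitivity_function [OF delone_layered_set rep T]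
    have "0 \<le> repetitivity_function ?X T"
      using fn(1) by (simp add: repetition_radius_def)
    moreover have "repetitivity_function ?X T \<le> real CARD('n) * (408 * T + 615)"
      by (rule fn(2) [OF repetition_radius_layered_set [OF T]])
    moreover have "real CARD('n) * (408 * T + 615) \<le> real CARD('n) * (1023 * T)"
      using that by (intro mult_left_mono) auto
    ultimately have "0 \<le> repetitivity_function ?X T"
      "repetitivity_function ?X T \<le> real CARD('n) * (1023 * T)" by linarith+
    then show ?thesis using T by (simp add: mult.assoc)
  qed
  then have "repetitivity_function ?X \<in> O[at_top](\<lambda>T. T)"
    by (intro bigoI [of _ "real CARD('n) * 1023"]) (rule eventually_at_top_linorderI)
  with rep show ?thesis by (simp add: linearly_repetitive_def)
qed

section \<open>The address map\<close>

text \<open>Infinite descent: both numbers are even, and their halves solve the same equation with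
  smaller \<open>\<bar>b\<bar>\<close>.\<close>

lemma int_square_eq_2_square:
  fixes a b :: int
  assumes "a ^ 2 = 2 * b ^ 2"
  shows "b = 0"
  using assms
proof (induction "nat \<bar>b\<bar>" arbitrary: a b rule: less_induct)
  case less
  show ?case
  proof (rule ccontr)
    assume b: "b \<noteq> 0"
    have "even (a ^ 2)" using less.prems by simp
    then obtain c where c: "a = 2 * c" by auto
    have bc: "b ^ 2 = 2 * c ^ 2" using less.prems c by (simp add: power2_eq_square)
    then have "even (b ^ 2)" by simp
    then obtain d where d: "b = 2 * d" by auto
    have "c ^ 2 = 2 * d ^ 2" using bc d by (simp add: power2_eq_square)
    moreover have "nat \<bar>d\<bar> < nat \<bar>b\<bar>" using b d by auto
    ultimately have "d = 0" using less.hyps by blast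
    then show False using b d by simp
  qed
qed

text \<open>This makes the number of letters and the number of plus signs two separate address
  coordinates.\<close>

lemma int_sqrt2_independent:
  fixes a b :: int
  assumes "of_int a + sqrt 2 * of_int b = 0"
  shows "a = 0 \<and> b = 0"
proof -
  have "real_of_int a = - (sqrt 2 * of_int b)" using assms by simp
  then have "(real_of_int a) ^ 2 = 2 * (real_of_int b) ^ 2" by (simp add: power_mult_distrib)
  then have "a ^ 2 = 2 * b ^ 2"
    by (metis of_int_eq_iff of_int_mult of_int_numeral of_int_power)
  then have "b = 0" by (rule int_square_eq_2_square)
  with assms show ?thesis by simp
qed

section \<open>An integral basis of the group generated by the set\<close>

text \<open>\<open>b\<close> enumerates the directions. Direction \<open>k\<close> carries two basis
  vectors, so the rank is one more than the dimension, and the extra vector has index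
  \<open>CARD('n)\<close>.\<close>

definition layered_basis :: "(nat \<Rightarrow> 'n) \<Rightarrow> 'n \<Rightarrow> nat \<Rightarrow> real ^ 'n::finite" where
  "layered_basis b k j = (if j < CARD('n) then axis (b j) 1 else axis k (sqrt 2))"

text \<open>The index \<open>N\<close> with \<open>x $ k = point N\<close> is passed along, since it
  determines both coordinates belonging to direction \<open>k\<close>. The floor only converts
  integral reals to integers.\<close>

definition layered_coords :: "(nat \<Rightarrow> 'n) \<Rightarrow> 'n \<Rightarrow> int \<Rightarrow> real ^ 'n::finite \<Rightarrow> nat \<Rightarrow> int" where
  "layered_coords b k N x j =
    (if j < CARD('n) then if b j = k then N else \<lfloor>x $ b j\<rfloor> else plus_count N)"

text \<open>On average half of the letters are plus signs, so \<open>point N\<close> is about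
  \<open>(2 + sqrt 2) / 2 * N\<close>; inverting this gives the coefficients for \<open>N\<close>
  and for \<open>plus_count N\<close>.\<close>

definition layered_linear :: "(nat \<Rightarrow> 'n) \<Rightarrow> 'n \<Rightarrow> real ^ 'n::finite \<Rightarrow> nat \<Rightarrow> real" where
  "layered_linear b k x j =
    (if j < CARD('n) then if b j = k then 2 / (2 + sqrt 2) * x $ k else x $ b j
     else 1 / (2 + sqrt 2) * x $ k)"

lemma layered_combination_component:
  fixes b :: "nat \<Rightarrow> 'n::finite" and m :: "nat \<Rightarrow> int"
  assumes b: "bij_betw b {..<CARD('n)} UNIV" and i: "i < CARD('n)"
  shows "(\<Sum>j<Suc CARD('n). of_int (m j) *\<^sub>R layered_basis b k j) $ b i =
    of_int (m i) + (if b i = k then sqrt 2 * of_int (m CARD('n)) else 0)"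
proof -
  have "(\<Sum>j<CARD('n). (of_int (m j) *\<^sub>R layered_basis b k j) $ b i) =
      (\<Sum>j<CARD('n). if j = i then of_int (m j) else 0)"
  proof (rule sum.cong)
    fix j assume "j \<in> {..<CARD('n)}"
    moreover from this have "b j = b i \<longleftrightarrow> j = i"
      using b i by (auto simp: bij_betw_def inj_on_def)
    ultimately show "(of_int (m j) *\<^sub>R layered_basis b k j) $ b i = (if j = i then of_int (m j) else 0)"
      by (auto simp: layered_basis_def axis_def)
  qed simp
  also have "\<dots> = of_int (m i)" using i by simp
  finally show ?thesis
    by (simp add: layered_basis_def axis_def)
qed

lemma layered_coords_combination:
  fixes b :: "nat \<Rightarrow> 'n::finite"
  assumes b: "bij_betw b {..<CARD('n)} UNIV" and x: "x \<in> layered_set k" "x $ k = point N"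
  shows "x = (\<Sum>j<Suc CARD('n). of_int (layered_coords b k N x j) *\<^sub>R layered_basis b k j)"
proof -
  have "x $ i = (\<Sum>j<Suc CARD('n). of_int (layered_coords b k N x j) *\<^sub>R layered_basis b k j) $ i" for i
  proof -
    obtain i' where i': "i' < CARD('n)" "b i' = i" using b by (metis UNIV_I bij_betw_imp_surj_on imageE lessThan_iff)
    show ?thesis
      using layered_combination_component [OF b i'(1), of "layered_coords b k N x" k] i' x
      by (auto simp: layered_coords_def point_def layered_set_def)
  qed
  then show ?thesis unfolding vec_eq_iff by blast
qed

lemma axis_point_in_layered_set: "axis k (point n) \<in> layered_set k"
  by (auto simp: layered_set_def axis_def)

lemma zero_in_layered_set: "0 \<in> layered_set k"
  by (auto simp: layered_set_def intro: range_eqI [of _ _ 0])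

text \<open>The first two letters are + and -. Hence \<open>point 2 - point 1\<close> is 1, and
  subtracting this from \<open>point 1\<close> leaves \<open>sqrt 2\<close>.\<close>

lemma layered_basis_in_closure: "layered_basis b k j \<in> group_closure (layered_set k)"
proof -
  let ?G = "group_closure (layered_set k)"
  have axis: "axis k (point n) \<in> ?G" for n
    using axis_point_in_layered_set by (intro group_closure.base) auto
  have word: "word 0 = 1" "word 1 = - 1"
    using word_inflate [of 1 0] by (simp_all add: block_sign_def)
  have pts: "point 1 = 1 + sqrt 2" "point 2 = 2 + sqrt 2"
    using plus_count_step [of 0] plus_count_step [of 1] word by (simp_all add: point_def letter_def)
  have "axis k (point 2) - axis k (point 1) = axis k (1::real)"
    using pts by (simp add: vec_eq_iff axis_def)
  then have one: "axis k 1 \<in> ?G"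
    using group_closure.diff [OF axis [of 2] axis [of 1]] by simp
  have "axis k (point 1) - axis k 1 = axis k (sqrt 2)"
    using pts by (simp add: vec_eq_iff axis_def)
  then have "axis k (sqrt 2) \<in> ?G"
    using group_closure.diff [OF axis [of 1] one] by simp
  moreover have "axis i 1 \<in> ?G" for i
  proof (cases "i = k")
    case False
    then have "axis i 1 \<in> layered_set k"
      using point_0 by (auto simp: layered_set_def axis_def image_iff intro: exI [of _ 0])
    then show ?thesis by (intro group_closure.base) auto
  qed (use one in simp)
  ultimately show ?thesis by (simp add: layered_basis_def)
qed

lemma int_basis_layered_set:
  fixes b :: "nat \<Rightarrow> 'n::finite"
  assumes b: "bij_betw b {..<CARD('n)} UNIV"
  shows "int_basis (group_closure (layered_set k)) (Suc CARD('n)) (layered_basis b k)"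
  unfolding int_basis_def
proof (intro conjI allI ballI impI)
  show "layered_basis b k j \<in> group_closure (layered_set k)" for j
    by (rule layered_basis_in_closure)
  fix g assume "g \<in> group_closure (layered_set k)"
  then show "\<exists>m::nat \<Rightarrow> int. g = (\<Sum>j<Suc CARD('n). of_int (m j) *\<^sub>R layered_basis b k j)"
  proof induction
    case (base x)
    \<comment> \<open>The generators of \<open>group_closure\<close> include 0, so membership of 0
      in the set is what makes the base case uniform.\<close>
    have "0 \<in> layered_set k" by (rule zero_in_layered_set)
    with base have x: "x \<in> layered_set k" by auto
    then obtain N where "x $ k = point N" by (auto simp: layered_set_def)
    with layered_coords_combination [OF b x] show ?case by blast
  next
    case (diff x y)
    then obtain m m' :: "nat \<Rightarrow> int" where
      "x = (\<Sum>j<Suc CARD('n). of_int (m j) *\<^sub>R layered_basis b k j)"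
      "y = (\<Sum>j<Suc CARD('n). of_int (m' j) *\<^sub>R layered_basis b k j)" by blast
    then have "x - y = (\<Sum>j<Suc CARD('n). of_int (m j - m' j) *\<^sub>R layered_basis b k j)"
      by (simp only: of_int_diff scaleR_left_diff_distrib sum_subtractf)
    then show ?case by (rule exI [of _ "\<lambda>j. m j - m' j"])
  qed
next
  fix m :: "nat \<Rightarrow> int" and j
  assume z: "(\<Sum>j<Suc CARD('n). of_int (m j) *\<^sub>R layered_basis b k j) = 0" and j: "j < Suc CARD('n)"
  have comp: "of_int (m i) + (if b i = k then sqrt 2 * of_int (m CARD('n)) else 0) = (0::real)"
    if "i < CARD('n)" for i
    using layered_combination_component [OF b that, of m k] unfolding z by simp
  obtain i where i: "i < CARD('n)" "b i = k" using b by (metis UNIV_I bij_betw_imp_surj_on imageE lessThan_iff)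
  have "m i = 0 \<and> m CARD('n) = 0"
    using comp [OF i(1)] i by (intro int_sqrt2_independent) simp
  then show "m j = 0" using comp [of j] j by (cases "j = CARD('n)") (auto split: if_splits)
qed

text \<open>Coordinates are chosen by \<open>SOME\<close>; linear independence makes the entries
  below \<open>s\<close> unique, and values off the group remain arbitrary.\<close>

lemma address_map_exists:
  assumes "int_basis (group_closure X) s y"
  obtains \<phi> where "address_map X s \<phi>"
    "\<And>(m::nat \<Rightarrow> int) i. i < s \<Longrightarrow> \<phi> (\<Sum>j<s. of_int (m j) *\<^sub>R y j) i = m i"
proof -
  define \<phi> :: "'a \<Rightarrow> nat \<Rightarrow> int" where "\<phi> x = (SOME m. x = (\<Sum>j<s. of_int (m j) *\<^sub>R y j))" for x
  have indep: "m i = 0" if "(\<Sum>j<s. of_int (m j) *\<^sub>R y j) = 0" "i < s" for m i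
    using assms that by (simp add: int_basis_def)
  have \<phi>: "\<phi> (\<Sum>j<s. of_int (m j) *\<^sub>R y j) i = m i" if "i < s" for m i
  proof -
    let ?x = "\<Sum>j<s. of_int (m j) *\<^sub>R y j"
    have "?x = (\<Sum>j<s. of_int (\<phi> ?x j) *\<^sub>R y j)"
      unfolding \<phi>_def by (rule someI [of _ m]) (rule refl)
    then have "(\<Sum>j<s. of_int (\<phi> ?x j - m j) *\<^sub>R y j) = 0"
      by (simp add: scaleR_left_diff_distrib sum_subtractf)
    from indep [OF this that] have "\<phi> ?x i - m i = 0" .
    then show ?thesis by simp
  qed
  then have "address_map X s \<phi>" using assms unfolding address_map_def by blast
  with \<phi> show thesis by (intro that)
qed

text \<open>The deviation vector is the discrepancy times a fixed vector, with entries
  \<open>- sqrt 2 / (2 + sqrt 2)\<close> and \<open>1 / (2 + sqrt 2)\<close> in the two coordinates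
  of direction \<open>k\<close> and 0 elsewhere. The sum of absolute values bounds its norm above,
  the last entry below.\<close>

lemma address_deviation_layered_set:
  fixes b :: "nat \<Rightarrow> 'n::finite"
  assumes b: "bij_betw b {..<CARD('n)} UNIV" and x: "x \<in> layered_set k" "x $ k = point N"
    and \<phi>: "\<And>j. j < Suc CARD('n) \<Longrightarrow> \<phi> x j = layered_coords b k N x j"
  defines "dev \<equiv> address_deviation (Suc CARD('n)) \<phi> (layered_linear b k) x"
  shows "dev \<le> \<bar>of_int (discrepancy N)\<bar>"
    and "\<bar>of_int (discrepancy N)\<bar> / 4 \<le> dev"
proof -
  define D where "D = real_of_int (discrepancy N)"
  define f where "f j = of_int (\<phi> x j) - layered_linear b k x j" for j
  have dev: "dev = L2_set f {..<Suc CARD('n)}"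
    unfolding dev_def address_deviation_def f_def by (rule refl)
  obtain i where i: "i < CARD('n)" "b i = k" using b by (metis UNIV_I bij_betw_imp_surj_on imageE lessThan_iff)
  have bj: "b j = k \<longleftrightarrow> j = i" if "j < CARD('n)" for j
    using b i that by (auto simp: bij_betw_def inj_on_def)
  have pos: "0 < 2 + sqrt 2" by (simp add: add_pos_pos)
  have s2: "sqrt 2 * (sqrt 2 * z) = 2 * z" for z by (simp add: mult.assoc [symmetric])
  have fn: "f CARD('n) = D / (2 + sqrt 2)"
    using pos by (simp add: f_def \<phi> layered_coords_def layered_linear_def x D_def discrepancy_def
        point_def field_simps s2)
  have fi: "f i = - sqrt 2 * D / (2 + sqrt 2)"
    using pos i by (simp add: f_def \<phi> layered_coords_def layered_linear_def x D_def discrepancy_def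
        point_def field_simps s2)
  have f0: "f j = 0" if "j < CARD('n)" "j \<noteq> i" for j
    using that bj x(1) by (auto simp: f_def \<phi> layered_coords_def layered_linear_def layered_set_def)
  have abs_f: "\<bar>f i\<bar> = sqrt 2 * \<bar>D\<bar> / (2 + sqrt 2)" "\<bar>f CARD('n)\<bar> = \<bar>D\<bar> / (2 + sqrt 2)"
    using pos by (simp_all add: fi fn abs_mult)
  have "dev \<le> (\<Sum>j<Suc CARD('n). \<bar>f j\<bar>)" unfolding dev by (rule L2_set_le_sum_abs)
  also have "\<dots> = (\<Sum>j<CARD('n). \<bar>f j\<bar>) + \<bar>f CARD('n)\<bar>" by simp
  also have "(\<Sum>j<CARD('n). \<bar>f j\<bar>) = (\<Sum>j<CARD('n). if j = i then \<bar>f i\<bar> else 0)"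
    using f0 by (intro sum.cong) auto
  also have "(\<Sum>j<CARD('n). if j = i then \<bar>f i\<bar> else 0) + \<bar>f CARD('n)\<bar> =
      \<bar>D\<bar> * ((1 + sqrt 2) / (2 + sqrt 2))"
    using i by (simp add: abs_f add_divide_distrib distrib_left mult.commute)
  also have "\<dots> \<le> \<bar>D\<bar>"
    using pos by (intro mult_left_le) auto
  finally show "dev \<le> \<bar>of_int (discrepancy N)\<bar>" by (simp add: D_def)
  have "\<bar>D\<bar> / 4 \<le> \<bar>D\<bar> / (2 + sqrt 2)"
    using sqrt2_bounds pos by (intro divide_left_mono) auto
  also have "\<dots> = \<bar>f CARD('n)\<bar>" by (simp add: abs_f)
  also have "\<dots> \<le> dev"
    unfolding dev using member_le_L2_set [of "{..<Suc CARD('n)}" "CARD('n)" "\<lambda>j. \<bar>f j\<bar>"]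
    by (simp add: L2_set_def)
  finally show "\<bar>of_int (discrepancy N)\<bar> / 4 \<le> dev" by (simp add: D_def)
qed

text \<open>The fourth root of \<open>4 ^ Suc n\<close> is 2 to the power
  \<open>(n + 1) / 2\<close>, and \<open>(n + 1) / 2 < n - 2\<close> holds exactly when
  \<open>n > 5\<close>.\<close>

lemma power_4_powr_less:
  fixes a :: real
  assumes "6 \<le> n" "0 \<le> a" "a \<le> 3 * 4 ^ n"
  shows "a powr (1 / 4) < 2 ^ n / 4"
proof -
  have "a powr (1 / 4) \<le> (4 ^ Suc n) powr (1 / 4)"
    using assms by (intro powr_mono2) auto
  also have "4 ^ Suc n = (2::real) ^ (2 * Suc n)" by (simp add: power_mult)
  also have "\<dots> = 2 powr real (2 * Suc n)" by (simp only: powr_realpow zero_less_numeral)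
  also have "\<dots> powr (1 / 4) = 2 powr (real (Suc n) / 2)"
    unfolding powr_powr by (rule arg_cong [of _ _ "(powr) 2"]) simp
  also have "\<dots> < 2 powr (real n - 2)" using assms by (intro powr_less_mono) auto
  also have "\<dots> = 2 ^ n / 4" by (simp add: powr_diff powr_realpow)
  finally show ?thesis .
qed

theorem mainTheorem5:
  shows "\<exists>(X :: (real ^ 'n) set) (s :: nat) (\<phi> :: real ^ 'n \<Rightarrow> nat \<Rightarrow> int) (L :: real ^ 'n \<Rightarrow> nat \<Rightarrow> real).
           delone X \<and> linearly_repetitive X \<and> 0 \<in> X \<and>
           address_map X s \<phi> \<and> associated_linear_map X s \<phi> L \<and>
           (\<exists>\<delta><1. \<exists>x :: nat \<Rightarrow> real ^ 'n.
              range x \<subseteq> X \<and>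
              filterlim (\<lambda>i. norm (x i)) at_top sequentially \<and>
              (\<forall>i. address_deviation s \<phi> L (x i) > norm (x i) powr (1 - \<delta>)))"
proof -
  obtain b :: "nat \<Rightarrow> 'n" where b: "bij_betw b {..<CARD('n)} UNIV"
    using ex_bij_betw_nat_finite [of "UNIV :: 'n set"] by (auto simp: atLeast0LessThan)
  define k where "k = b 0"
  define X where "X = layered_set k"
  define s where "s = Suc CARD('n)"
  define L where "L = layered_linear b k"
  obtain \<phi> where addr: "address_map X s \<phi>"
    and \<phi>: "\<And>(m::nat \<Rightarrow> int) i. i < s \<Longrightarrow> \<phi> (\<Sum>j<s. of_int (m j) *\<^sub>R layered_basis b k j) i = m i"
    using address_map_exists [OF int_basis_layered_set [OF b, of k]] unfolding X_def s_def by blast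
  have dev: "address_deviation s \<phi> L x \<le> \<bar>of_int (discrepancy N)\<bar>"
      "\<bar>of_int (discrepancy N)\<bar> / 4 \<le> address_deviation s \<phi> L x"
    if "x \<in> X" "x $ k = point N" for x N
  proof -
    have x: "x \<in> layered_set k" using that by (simp add: X_def)
    have "\<phi> x j = layered_coords b k N x j" if "j < Suc CARD('n)" for j
      using \<phi> [of j "layered_coords b k N x"] layered_coords_combination [OF b x \<open>x $ k = point N\<close>] that
      by (simp add: s_def)
    from address_deviation_layered_set [of b x k N \<phi>, OF b x \<open>x $ k = point N\<close> this]
    show "address_deviation s \<phi> L x \<le> \<bar>of_int (discrepancy N)\<bar>"
      "\<bar>of_int (discrepancy N)\<bar> / 4 \<le> address_deviation s \<phi> L x"
      by (simp_all add: s_def L_def)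
  qed
  have "address_deviation s \<phi> L \<in> o[inf at_infinity (principal X)](norm)"
  proof (rule landau_o.smallI)
    fix e :: real assume e: "e > 0"
    \<comment> \<open>Half of \<open>e\<close> goes to the linear term; the other half absorbs
      \<open>B\<close> once the norm is at least \<open>2 * B / e\<close>.\<close>
    obtain B where B: "\<And>n. \<bar>real_of_int (discrepancy n)\<bar> \<le> e / 2 * \<bar>real_of_int n\<bar> + B"
      using discrepancy_sublinear [of "e / 2"] e by auto
    have "norm (address_deviation s \<phi> L x) \<le> e * norm (norm x)"
      if x: "x \<in> X" and large: "2 * B / e \<le> norm x" for x
    proof -
      obtain N where N: "x $ k = point N" using x by (auto simp: X_def layered_set_def)
      have "\<bar>real_of_int N\<bar> \<le> norm x"
        using point_diff_bounds(1) [of N 0] component_le_norm_cart [of x k] N by simp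
      then have "e / 2 * \<bar>real_of_int N\<bar> \<le> e / 2 * norm x" using e by (intro mult_left_mono) auto
      moreover have "B \<le> e / 2 * norm x" using large e by (simp add: field_simps)
      ultimately have "address_deviation s \<phi> L x \<le> e * norm x"
        using dev(1) [OF x N] B [of N] by linarith
      then show ?thesis by (simp add: address_deviation_def L2_set_nonneg)
    qed
    then show "\<forall>\<^sub>F x in inf at_infinity (principal X).
        norm (address_deviation s \<phi> L x) \<le> e * norm (norm x)"
      by (auto simp: eventually_inf_principal eventually_at_infinity)
  qed
  moreover have "linear (\<lambda>x. L x i)" for i
    unfolding L_def layered_linear_def
    by (rule linearI) (auto simp: distrib_left)
  ultimately have lin: "associated_linear_map X s \<phi> L"
    by (simp add: associated_linear_map_def)
  \<comment> \<open>At powers of 4 the discrepancy is known exactly; the shift by 6 meets the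
    hypothesis of \<open>power_4_powr_less\<close>.\<close>
  define x :: "nat \<Rightarrow> real ^ 'n" where "x i = axis k (point (4 ^ (i + 6)))" for i
  have x: "x i \<in> X" "x i $ k = point (4 ^ (i + 6))" for i
    unfolding x_def X_def by (rule axis_point_in_layered_set) (simp add: axis_def)
  have norm_x: "4 ^ (i + 6) \<le> norm (x i)" "norm (x i) \<le> 3 * 4 ^ (i + 6)" for i
    using point_diff_bounds [of "4 ^ (i + 6)" 0] by (simp_all add: x_def norm_eq_sqrt_inner inner_axis_axis)
  have "filterlim (\<lambda>i. norm (x i)) at_top sequentially"
  proof (rule filterlim_at_top_mono)
    show "filterlim (\<lambda>i. real i) at_top sequentially" by (rule filterlim_real_sequentially)
    have "real i \<le> norm (x i)" for i
    proof -
      have "real i \<le> 4 ^ i"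
        using of_nat_less_two_power [of i, where 'a = real] power_mono [of 2 "4::real" i] by linarith
      also have "\<dots> \<le> 4 ^ (i + 6)" by (intro power_increasing) auto
      finally show ?thesis using norm_x(1) [of i] by linarith
    qed
    then show "\<forall>\<^sub>F i in sequentially. real i \<le> norm (x i)" by simp
  qed
  \<comment> \<open>The deviation grows like the square root of the norm; the exponent 1/4 lies
    below 1/2 and leaves room for the constants 3 and 1/4.\<close>
  moreover have "norm (x i) powr (1 - 3 / 4) < address_deviation s \<phi> L (x i)" for i
  proof -
    have "norm (x i) powr (1 / 4) < 2 ^ (i + 6) / 4"
      using norm_x(2) [of i] by (intro power_4_powr_less) auto
    also have "\<dots> \<le> address_deviation s \<phi> L (x i)"
      using dev(2) [OF x [of i]] by (simp add: discrepancy_power_4)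
    finally show ?thesis by simp
  qed
  moreover have "range x \<subseteq> X" using x by auto
  moreover have "(3 / 4 :: real) < 1" by simp
  ultimately have "\<exists>\<delta><1. \<exists>x :: nat \<Rightarrow> real ^ 'n. range x \<subseteq> X \<and>
      filterlim (\<lambda>i. norm (x i)) at_top sequentially \<and>
      (\<forall>i. address_deviation s \<phi> L (x i) > norm (x i) powr (1 - \<delta>))"
    by blast
  moreover have "0 \<in> X" unfolding X_def by (rule zero_in_layered_set)
  moreover have "delone X" "linearly_repetitive X"
    unfolding X_def by (rule delone_layered_set linearly_repetitive_layered_set)+
  ultimately show ?thesis using addr lin by blast
qed

end
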